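(* Let $N\ge 1$ be an integer, and let $\psi:\mathbb{Q}[x_0,\ldots,x_N]\to\mathbb{Q}[x_0,\ldots,x_N]$ be a $(\mathcal{D},\mathcal{D}_{\mathcal{K}_1})$-intertwining map, and suppose that it has the form $$\psi(x_0)=x_0,\qquad \psi(x_n)=\sum_{i=1}^n T(n,i)\,x_i\quad(1\le n\le N).$$ Then the numbers $T(n,i)$ have the following explicit form: $$T(n,i)=\sum_{j=i}^n(-1)^{j-i}\,2^{n-j}\,j!\,S(n,j)\binom{j-1}{i-1},$$ where $S(n,j)$ are the Stirling numbers of the second kind.
   Context: A derivation of $\mathbb{Q}[x_0,\ldots,x_N]$ is a $\mathbb{Q}$-linear map satisfying the Leibniz rule; it is determined by its values on the variables. The basic Weitzenböck derivation is $\mathcal{D}=x_0\frac{\partial}{\partial x_1}+2x_1\frac{\partial}{\partial x_2}+\cdots+N x_{N-1}\frac{\partial}{\partial x_N}$, i.e. $\mathcal{D}(x_0)=0$ and $\mathcal{D}(x_n)=n\,x_{n-1}$ for $1\le n\le N$. The first Kravchuk derivation $\mathcal{D}_{\mathcal{K}_1}$ is the derivation with $$\mathcal{D}_{\mathcal{K}_1}(x_0)=0,\qquad \mathcal{D}_{\mathcal{K}_1}(x_n)=\sum_{i=1}^{n}\frac{1-(-1)^i}{2i}\,x_{n-i}\quad(1\le n\le N).$$ A $(\mathcal{D},\mathcal{D}_{\mathcal{K}_1})$-intertwining map is a multiplicative linear map $\psi$ with $\psi\,\mathcal{D}=\mathcal{D}_{\mathcal{K}_1}\psi$. The coefficients $T(n,i)$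 are those with $1\le i\le n\le N$. *)

theory Defs
  imports Complex_Main "HOL-Library.Poly_Mapping" "HOL-Combinatorics.Stirling"
begin

(* Polynomials over the rationals in variables indexed by nat: finitely supported maps from
   exponent vectors to coefficients. *)
type_synonym qpoly = "(nat \<Rightarrow>\<^sub>0 nat) \<Rightarrow>\<^sub>0 rat"

definition polys :: "nat \<Rightarrow> qpoly set" where
  "polys N = {p. \<forall>m\<in>Poly_Mapping.keys p. Poly_Mapping.keys m \<subseteq> {..N}}"

definition var :: "nat \<Rightarrow> qpoly" where
  "var n = Poly_Mapping.single (Poly_Mapping.single n 1) 1"

definition scale :: "rat \<Rightarrow> qpoly \<Rightarrow> qpoly" where
  "scale c p = Poly_Mapping.single 0 c * p"

(* If n does not occur in the monomial m, the truncated subtraction is harmless because the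
   coefficient is 0. *)
definition partial_deriv :: "nat \<Rightarrow> qpoly \<Rightarrow> qpoly" where
  "partial_deriv n p = (\<Sum>m\<in>Poly_Mapping.keys p.
     Poly_Mapping.single (m - Poly_Mapping.single n 1) (of_nat (Poly_Mapping.lookup m n) * Poly_Mapping.lookup p m))"

definition weitzenboeck :: "nat \<Rightarrow> qpoly \<Rightarrow> qpoly" where
  "weitzenboeck N p = (\<Sum>n=1..N. scale (of_nat n) (var (n - 1)) * partial_deriv n p)"

definition kravchuk1_var :: "nat \<Rightarrow> qpoly" where
  "kravchuk1_var n = (\<Sum>i=1..n. scale ((1 - (-1) ^ i) / (2 * of_nat i)) (var (n - i)))"

definition kravchuk1 :: "nat \<Rightarrow> qpoly \<Rightarrow> qpoly" where
  "kravchuk1 N p = (\<Sum>n=1..N. kravchuk1_var n * partial_deriv n p)"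

definition linear_on_polys :: "nat \<Rightarrow> (qpoly \<Rightarrow> qpoly) \<Rightarrow> bool" where
  "linear_on_polys N f \<longleftrightarrow>
     f ` polys N \<subseteq> polys N \<and>
     (\<forall>p\<in>polys N. \<forall>q\<in>polys N. f (p + q) = f p + f q) \<and>
     (\<forall>c. \<forall>p\<in>polys N. f (scale c p) = scale c (f p))"

definition derivation_on :: "nat \<Rightarrow> (qpoly \<Rightarrow> qpoly) \<Rightarrow> bool" where
  "derivation_on N d \<longleftrightarrow> linear_on_polys N d \<and>
     (\<forall>p\<in>polys N. \<forall>q\<in>polys N. d (p * q) = d p * q + p * d q)"

definition intertwining_map ::
    "nat \<Rightarrow> (qpoly \<Rightarrow> qpoly) \<Rightarrow> (qpoly \<Rightarrow> qpoly) \<Rightarrow> (qpoly \<Rightarrow> qpoly) \<Rightarrow> bool" where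
  "intertwining_map N d1 d2 \<psi> \<longleftrightarrow> linear_on_polys N \<psi> \<and>
     (\<forall>p\<in>polys N. \<forall>q\<in>polys N. \<psi> (p * q) = \<psi> p * \<psi> q) \<and>
     (\<forall>p\<in>polys N. \<psi> (d1 p) = d2 (\<psi> p))"


lemma polys_closed [simp, intro]:
  "0 \<in> polys N" "1 \<in> polys N"
  "p \<in> polys N \<Longrightarrow> q \<in> polys N \<Longrightarrow> p + q \<in> polys N"
  "p \<in> polys N \<Longrightarrow> q \<in> polys N \<Longrightarrow> p * q \<in> polys N"
  "p \<in> polys N \<Longrightarrow> scale c p \<in> polys N"
  "n \<le> N \<Longrightarrow> var n \<in> polys N"
proof -
  show "0 \<in> polys N" "1 \<in> polys N"
    by (auto simp: polys_def)
  show "p + q \<in> polys N" if "p \<in> polys N" "q \<in> polys N" for p q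
    using that keys_add[of p q] by (fastforce simp: polys_def)
  have mult: "p * q \<in> polys N" if "p \<in> polys N" "q \<in> polys N" for p q
    unfolding polys_def
  proof (intro CollectI ballI)
    fix m assume "m \<in> Poly_Mapping.keys (p * q)"
    then obtain a b where "a \<in> Poly_Mapping.keys p" "b \<in> Poly_Mapping.keys q" "m = a + b"
      using keys_mult[of p q] by blast
    then show "Poly_Mapping.keys m \<subseteq> {..N}"
      using that keys_add[of a b] unfolding polys_def by blast
  qed
  then show "p * q \<in> polys N" if "p \<in> polys N" "q \<in> polys N"
    using that .
  have "Poly_Mapping.single 0 c \<in> polys N"
    by (auto simp: polys_def)
  then show "scale c p \<in> polys N" if "p \<in> polys N"
    using that mult unfolding scale_def by blast
  show "var n \<in> polys N" if "n \<le> N"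
    using that by (auto simp: polys_def var_def)
qed

lemma sum_polys [intro]: "(\<And>i. i \<in> A \<Longrightarrow> f i \<in> polys N) \<Longrightarrow> sum f A \<in> polys N"
  by (induction A rule: infinite_finite_induct) auto

lemma partial_deriv_superset:
  assumes "finite A" "Poly_Mapping.keys p \<subseteq> A"
  shows "partial_deriv n p = (\<Sum>m\<in>A.
     Poly_Mapping.single (m - Poly_Mapping.single n 1) (of_nat (Poly_Mapping.lookup m n) * Poly_Mapping.lookup p m))"
  unfolding partial_deriv_def
  by (rule sum.mono_neutral_left) (use assms in \<open>auto simp: in_keys_iff\<close>)

lemma partial_deriv_add: "partial_deriv n (p + q) = partial_deriv n p + partial_deriv n q"
proof -
  let ?A = "Poly_Mapping.keys p \<union> Poly_Mapping.keys q"
  have "Poly_Mapping.keys (p + q) \<subseteq> ?A" by (rule keys_add)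
  then show ?thesis
    by (subst (1 2 3) partial_deriv_superset[where A = ?A])
       (auto simp: lookup_add ring_distribs single_add sum.distrib)
qed

lemma partial_deriv_zero [simp]: "partial_deriv n 0 = 0"
  by (simp add: partial_deriv_def)

lemma partial_deriv_sum: "partial_deriv n (sum f A) = (\<Sum>i\<in>A. partial_deriv n (f i))"
  by (induction A rule: infinite_finite_induct) (auto simp: partial_deriv_add)

lemma partial_deriv_single:
  "partial_deriv n (Poly_Mapping.single m c) =
     Poly_Mapping.single (m - Poly_Mapping.single n 1) (of_nat (Poly_Mapping.lookup m n) * c)"
  by (subst partial_deriv_superset[where A = "{m}"]) auto

lemma qpoly_expansion: "p = (\<Sum>m\<in>Poly_Mapping.keys p. Poly_Mapping.single m (Poly_Mapping.lookup p m))"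
  for p :: qpoly
proof (rule poly_mapping_eqI)
  fix k
  show "Poly_Mapping.lookup p k = Poly_Mapping.lookup (\<Sum>m\<in>Poly_Mapping.keys p. Poly_Mapping.single m (Poly_Mapping.lookup p m)) k"
    by (cases "k \<in> Poly_Mapping.keys p") (auto simp: lookup_sum lookup_single when_def in_keys_iff)
qed

lemma exponent_diff_aux:
  fixes a b :: "nat \<Rightarrow>\<^sub>0 nat"
  assumes "Poly_Mapping.lookup a n \<noteq> 0"
  shows "a + b - Poly_Mapping.single n 1 = (a - Poly_Mapping.single n 1) + b"
  using assms by (intro poly_mapping_eqI)
    (auto simp: lookup_add lookup_minus lookup_single when_def)

lemma partial_deriv_mult_single:
  fixes a b :: "nat \<Rightarrow>\<^sub>0 nat" and c d :: rat
  shows "partial_deriv n (Poly_Mapping.single a c * Poly_Mapping.single b d) =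
    partial_deriv n (Poly_Mapping.single a c) * Poly_Mapping.single b d +
    Poly_Mapping.single a c * partial_deriv n (Poly_Mapping.single b d)"
proof -
  let ?e = "Poly_Mapping.single n (1 :: nat)"
  have 1: "Poly_Mapping.single (a + b - ?e) (of_nat (Poly_Mapping.lookup a n) * c * d) =
      Poly_Mapping.single ((a - ?e) + b) (of_nat (Poly_Mapping.lookup a n) * c * d)"
    using exponent_diff_aux[of a n b] by (cases "Poly_Mapping.lookup a n = 0") auto
  have 2: "Poly_Mapping.single (a + b - ?e) (of_nat (Poly_Mapping.lookup b n) * c * d) =
      Poly_Mapping.single (a + (b - ?e)) (of_nat (Poly_Mapping.lookup b n) * c * d)"
    using exponent_diff_aux[of b n a] by (cases "Poly_Mapping.lookup b n = 0") (auto simp: add.commute)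
  have "partial_deriv n (Poly_Mapping.single a c * Poly_Mapping.single b d) =
     Poly_Mapping.single (a + b - ?e) (of_nat (Poly_Mapping.lookup a n) * c * d) +
     Poly_Mapping.single (a + b - ?e) (of_nat (Poly_Mapping.lookup b n) * c * d)"
    by (simp add: mult_single partial_deriv_single lookup_add ring_distribs single_add[symmetric]
          mult.assoc)
  then show ?thesis
    by (simp only: 1 2 partial_deriv_single mult_single) (simp add: ac_simps)
qed

lemma partial_deriv_mult:
  "partial_deriv n (p * q) = partial_deriv n p * q + p * partial_deriv n q"
proof -
  have "partial_deriv n ((\<Sum>a\<in>A. Poly_Mapping.single a (f a)) * (\<Sum>b\<in>B. Poly_Mapping.single b (g b))) =
     partial_deriv n (\<Sum>a\<in>A. Poly_Mapping.single a (f a)) * (\<Sum>b\<in>B. Poly_Mapping.single b (g b)) +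
     (\<Sum>a\<in>A. Poly_Mapping.single a (f a)) * partial_deriv n (\<Sum>b\<in>B. Poly_Mapping.single b (g b))"
    for A B :: "(nat \<Rightarrow>\<^sub>0 nat) set" and f g :: "(nat \<Rightarrow>\<^sub>0 nat) \<Rightarrow> rat"
    by (simp add: sum_product partial_deriv_sum partial_deriv_mult_single sum.distrib)
  from this[of "Poly_Mapping.lookup p" "Poly_Mapping.keys p" "Poly_Mapping.lookup q" "Poly_Mapping.keys q"] show ?thesis
    by (simp add: qpoly_expansion[symmetric])
qed

lemma partial_deriv_scale: "partial_deriv n (scale c p) = scale c (partial_deriv n p)"
  by (simp add: scale_def partial_deriv_mult partial_deriv_single)

lemma partial_deriv_var: "partial_deriv n (var k) = (if n = k then 1 else 0)"
  by (auto simp: var_def partial_deriv_single lookup_single when_def)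

lemma partial_deriv_polys: "p \<in> polys N \<Longrightarrow> partial_deriv n p \<in> polys N"
  unfolding partial_deriv_def
proof (rule sum_polys)
  fix m assume "p \<in> polys N" "m \<in> Poly_Mapping.keys p"
  then have "Poly_Mapping.keys (m - Poly_Mapping.single n 1) \<subseteq> {..N}"
    by (auto simp: polys_def in_keys_iff lookup_minus subset_iff)
  then show "Poly_Mapping.single (m - Poly_Mapping.single n 1)
       (of_nat (Poly_Mapping.lookup m n) * Poly_Mapping.lookup p m) \<in> polys N"
    by (auto simp: polys_def split: if_splits)
qed

lemma mult_scale: "p * scale c q = scale c (p * q)"
  by (simp add: scale_def mult.left_commute)

lemma scale_sum: "scale c (sum f A) = (\<Sum>i\<in>A. scale c (f i))"
  by (simp add: scale_def sum_distrib_left)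

lemma derivation_on_partial_sum:
  assumes "\<And>n. n \<in> A \<Longrightarrow> v n \<in> polys N"
  shows "derivation_on N (\<lambda>p. \<Sum>n\<in>A. v n * partial_deriv n p)"
  unfolding derivation_on_def linear_on_polys_def
  using assms
  by (auto simp: partial_deriv_add partial_deriv_scale partial_deriv_mult mult_scale
      scale_sum ring_distribs sum.distrib sum_distrib_left sum_distrib_right mult.left_commute mult.assoc
      intro!: sum_polys partial_deriv_polys polys_closed)

lemma derivation_on_cong:
  assumes "\<And>p. p \<in> polys N \<Longrightarrow> d p = e p" "derivation_on N e"
  shows "derivation_on N d"
  using assms by (auto simp: derivation_on_def linear_on_polys_def image_subset_iff)

lemma derivation_on_unique:
  assumes d: "derivation_on N d" and e: "derivation_on N e"
    and eq: "\<And>n. n \<le> N \<Longrightarrow> d (var n) = e (var n)" and p: "p \<in> polys N"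
  shows "d p = e p"
proof -
  have one: "f 1 = 0" if "derivation_on N f" for f
  proof -
    have "f (1 * 1) = f 1 * 1 + 1 * f 1"
      using that polys_closed(2) unfolding derivation_on_def by blast
    then show ?thesis by simp
  qed
  have zero: "f 0 = 0" if "derivation_on N f" for f
  proof -
    have "f (0 + 0) = f 0 + f 0"
      using that polys_closed(1) unfolding derivation_on_def linear_on_polys_def by blast
    then show ?thesis by simp
  qed
  have mono: "d (Poly_Mapping.single m 1) = e (Poly_Mapping.single m 1)"
    if "Poly_Mapping.keys m \<subseteq> {..N}" for m
    using that
  proof (induction "\<Sum>k\<le>N. Poly_Mapping.lookup m k" arbitrary: m rule: less_induct)
    case less
    show ?case
    proof (cases "m = 0")
      case True
      then show ?thesis using one[OF d] one[OF e] by simp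
    next
      case False
      then obtain i where i: "i \<in> Poly_Mapping.keys m"
        by (metis all_not_in_conv keys_eq_empty)
      let ?m = "m - Poly_Mapping.single i 1"
      have m: "m = Poly_Mapping.single i 1 + ?m"
        using i by (intro poly_mapping_eqI)
          (auto simp: lookup_add lookup_minus lookup_single when_def in_keys_iff)
      have iN: "i \<le> N" using i less.prems by auto
      have k: "Poly_Mapping.keys ?m \<subseteq> {..N}"
        using less.prems by (auto simp: in_keys_iff lookup_minus subset_iff)
      have "(\<Sum>k\<le>N. Poly_Mapping.lookup ?m k) < (\<Sum>k\<le>N. Poly_Mapping.lookup m k)"
        by (rule sum_strict_mono_ex1)
          (use i iN in \<open>auto simp: lookup_minus lookup_single in_keys_iff intro!: bexI[of _ i]\<close>)
      then have IH: "d (Poly_Mapping.single ?m 1) = e (Poly_Mapping.single ?m 1)"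
        using less.hyps k by blast
      have split: "Poly_Mapping.single m 1 = var i * Poly_Mapping.single ?m 1"
        by (subst m) (simp add: var_def mult_single)
      have in_p: "var i \<in> polys N" "Poly_Mapping.single ?m 1 \<in> polys N"
        using iN k by (auto simp: polys_def var_def)
      show ?thesis
        unfolding split using d e in_p IH eq[OF iN] unfolding derivation_on_def by metis
    qed
  qed
  have trm: "Poly_Mapping.single m c = scale c (Poly_Mapping.single m 1)" for m c
    by (simp add: scale_def mult_single)
  have "sum f A \<in> polys N \<and> d (sum f A) = e (sum f A)"
    if "finite A" "\<And>m. m \<in> A \<Longrightarrow> f m \<in> polys N \<and> d (f m) = e (f m)" 
    for A and f :: "(nat \<Rightarrow>\<^sub>0 nat) \<Rightarrow> qpoly"
    using that
  proof (induction A rule: finite_induct)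
    case empty
    then show ?case using zero[OF d] zero[OF e] by simp
  next
    case (insert x A)
    then have "f x \<in> polys N" "sum f A \<in> polys N" "d (f x) = e (f x)" "d (sum f A) = e (sum f A)"
      by auto
    with d e insert.hyps show ?case
      by (simp add: derivation_on_def linear_on_polys_def)
  qed
  moreover have "Poly_Mapping.single m (Poly_Mapping.lookup p m) \<in> polys N \<and>
      d (Poly_Mapping.single m (Poly_Mapping.lookup p m)) = e (Poly_Mapping.single m (Poly_Mapping.lookup p m))"
    if "m \<in> Poly_Mapping.keys p" for m
  proof -
    have km: "Poly_Mapping.keys m \<subseteq> {..N}" using that p by (auto simp: polys_def)
    then have "Poly_Mapping.single m 1 \<in> polys N" by (auto simp: polys_def)
    then show ?thesis
      using d e mono[OF km] by (subst (1 2 3) trm) (auto simp: derivation_on_def linear_on_polys_def)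
  qed
  ultimately show ?thesis
    by (subst (1 2) qpoly_expansion) simp
qed

lemma derivation_on_characterization:
  assumes "\<And>n. n \<in> {1..N} \<Longrightarrow> v n \<in> polys N"
  shows "derivation_on N d \<and> d (var 0) = 0 \<and> (\<forall>n\<in>{1..N}. d (var n) = v n) \<longleftrightarrow>
     (\<forall>p\<in>polys N. d p = (\<Sum>n=1..N. v n * partial_deriv n p))" (is "?L \<longleftrightarrow> ?R")
proof -
  let ?e = "\<lambda>p. \<Sum>n=1..N. v n * partial_deriv n p"
  have e: "derivation_on N ?e"
    using assms by (rule derivation_on_partial_sum)
  have v: "?e (var k) = (if k \<in> {1..N} then v k else 0)" for k
    by (auto simp: partial_deriv_var if_distrib sum.delta cong: if_cong)
  show ?thesis
  proof
    assume L: ?L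
    have "d (var n) = ?e (var n)" if "n \<le> N" for n
      using L v[of n] that by (cases "n = 0") auto
    then show ?R using derivation_on_unique[OF _ e] L by blast
  next
    assume R: ?R
    then have "derivation_on N d" using derivation_on_cong[OF _ e] by blast
    moreover have "d (var n) = ?e (var n)" if "n \<le> N" for n
      using R that by blast
    ultimately show ?L using v by auto
  qed
qed

(* The two operators above are, on the polynomials in x_0, ..., x_N, exactly the derivations
   with the prescribed values on the variables. *)

lemma weitzenboeck_characterization:
  "derivation_on N d \<and> d (var 0) = 0 \<and>
     (\<forall>n\<in>{1..N}. d (var n) = scale (of_nat n) (var (n - 1))) \<longleftrightarrow>
   (\<forall>p\<in>polys N. d p = weitzenboeck N p)"
  unfolding weitzenboeck_def by (rule derivation_on_characterization) auto

lemma kravchuk1_characterization: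
  "derivation_on N d \<and> d (var 0) = 0 \<and>
     (\<forall>n\<in>{1..N}. d (var n) =
        (\<Sum>i=1..n. scale ((1 - (-1) ^ i) / (2 * of_nat i)) (var (n - i)))) \<longleftrightarrow>
   (\<forall>p\<in>polys N. d p = kravchuk1 N p)"
  unfolding kravchuk1_def kravchuk1_var_def[symmetric]
  by (rule derivation_on_characterization) (auto simp: kravchuk1_var_def)

end

theory Submission
  imports Defs "HOL-Computational_Algebra.Formal_Power_Series"
begin

unbundle fps_syntax

text \<open>
  Comparing the coefficients of \<open>x\<^sub>m\<close> in \<open>\<psi> (D x\<^sub>n) = D\<^sub>K (\<psi> x\<^sub>n)\<close> gives
  \<open>n T(n-1,m) = (\<Sum>i=m+1..n. c\<^sub>i\<^sub>-\<^sub>m T(n,i))\<close>, where the \<open>c\<^sub>k\<close> are the coefficients of \<open>artanh\<close>.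
  As \<open>c\<^sub>1 = 1\<close>, this determines \<open>T\<close>, and \<open>artanh (tanh t) = t\<close> shows that the exponential
  generating function of the \<open>i\<close>-th column is \<open>(tanh t)^i\<close>. With \<open>w = (exp (2t) - 1) / 2\<close>, the explicit
  formula is the expansion of \<open>tanh t = w / (1 + w)\<close>, because the powers of \<open>exp (2t) - 1\<close> generate
  the Stirling numbers.
\<close>

section \<open>Stirling numbers in the powers of exp (c t) - 1\<close>

text \<open>With E = exp (c t) - 1 one has E' = c (E + 1), so (E^(k+1))' = (k+1) c (E^(k+1) + E^k).
  On coefficients this is S(n+1,k+1) = (k+1) S(n,k+1) + S(n,k).\<close>

lemma fps_exp_minus_one_power_nth:
  fixes c :: "'a :: field_char_0"
  shows "((fps_exp c - 1) ^ j) $ n = c ^ n * fact j * of_nat (Stirling n j) / fact n"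
proof (induction n arbitrary: j)
  case 0
  show ?case by (cases j) (auto simp: fps_mult_nth)
next
  case (Suc n)
  show ?case
  proof (cases j)
    case 0
    then show ?thesis by simp
  next
    case (Suc k)
    let ?E = "fps_exp c - 1"
    have "fps_deriv (?E ^ Suc k) = fps_const (of_nat (Suc k) * c) * (?E ^ Suc k + ?E ^ k)"
      by (simp only: fps_deriv_power' diff_Suc_1 flip: fps_const_mult fps_of_nat)
        (simp add: algebra_simps)
    then have "fps_deriv (?E ^ Suc k) $ n = of_nat (Suc k) * c * (?E ^ Suc k + ?E ^ k) $ n"
      by (metis fps_mult_left_const_nth)
    then have "of_nat (Suc n) * (?E ^ Suc k) $ Suc n
        = of_nat (Suc k) * c * ((?E ^ Suc k) $ n + (?E ^ k) $ n)"
      by (simp only: fps_deriv_nth fps_add_nth Suc_eq_plus1)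
    also have "\<dots> = c ^ Suc n * fact (Suc k) * of_nat (Stirling (Suc n) (Suc k)) / fact n"
      unfolding Suc.IH by (simp add: field_simps)
    finally show ?thesis
      unfolding Suc by (simp add: field_simps del: of_nat_Suc Stirling.simps power_Suc)
  qed
qed

section \<open>Powers of x / (1 + x)\<close>

text \<open>The expansion of (x / (1 + x))^i. The case i = 0 is separate because truncation in
  \<open>i - 1\<close> would give wrong values there.\<close>

definition fps_geometric_power :: "nat \<Rightarrow> 'a :: field_char_0 fps" where
  "fps_geometric_power i = Abs_fps (\<lambda>j. if i = 0 then of_bool (j = 0)
     else if j < i then 0 else (-1) ^ (j - i) * of_nat ((j - 1) choose (i - 1)))"

lemma fps_geometric_power_0 [simp]: "fps_geometric_power 0 = 1"
  by (rule fps_ext) (auto simp: fps_geometric_power_def)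

lemma fps_geometric_power_Suc:
  "(1 + fps_X) * fps_geometric_power (Suc i) = fps_X * (fps_geometric_power i :: 'a :: field_char_0 fps)"
proof (rule fps_ext)
  fix n
  show "((1 + fps_X) * fps_geometric_power (Suc i)) $ n = (fps_X * (fps_geometric_power i :: 'a fps)) $ n"
  proof (cases n)
    case 0
    then show ?thesis by (simp add: fps_geometric_power_def)
  next
    case (Suc m)
    show ?thesis
    proof (cases i)
      case 0
      with Suc show ?thesis
        by (cases m) (auto simp: fps_geometric_power_def distrib_right)
    next
      case (Suc k)
      \<comment> \<open>With i = k + 1, all coefficients involved vanish for m \<le> k, and m = k +
        1 gives the leading term; from m = k + 2 on the identity is Pascal's rule with alternating
        signs.\<close>
      consider "m < k" | "m = k" | "m = Suc k" | d where "m = Suc (Suc (k + d))"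
        by (metis less_imp_Suc_add not_less_iff_gr_or_eq add_0_right add_Suc_right not0_implies_Suc)
      then show ?thesis
        using \<open>n = Suc m\<close> Suc
        by cases (auto simp: fps_geometric_power_def distrib_right Suc_diff_le algebra_simps split: nat.splits)
    qed
  qed
qed

lemma fps_geometric_power_eq: "fps_geometric_power i = (fps_geometric_power 1 :: 'a :: field_char_0 fps) ^ i"
proof (induction i)
  case (Suc i)
  have "(1 + fps_X) * fps_geometric_power (Suc i) = fps_X * (fps_geometric_power i :: 'a fps)"
    by (rule fps_geometric_power_Suc)
  also have "\<dots> = (1 + fps_X) * fps_geometric_power 1 ^ Suc i"
  proof -
    have "fps_X * fps_geometric_power i = ((1 + fps_X) * fps_geometric_power 1) * (fps_geometric_power 1 :: 'a fps) ^ i"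
      unfolding One_nat_def fps_geometric_power_Suc by (simp add: Suc.IH)
    then show ?thesis by (simp only: power_Suc mult.assoc)
  qed
  finally have "(1 + fps_X) * fps_geometric_power (Suc i) = (1 + fps_X) * (fps_geometric_power 1 :: 'a fps) ^ Suc i" .
  moreover have "(1 + fps_X :: 'a fps) $ 0 \<noteq> 0" by simp
  then have "(1 + fps_X :: 'a fps) \<noteq> 0" by (metis fps_zero_nth)
  ultimately show ?case by (metis mult_left_cancel)
qed simp

section \<open>Formal artanh and tanh\<close>

text \<open>These are the weights in \<open>kravchuk1_var\<close>: 1/k for odd k, else 0. The value
  at k = 0 is 0, so \<open>fps_artanh\<close> has no constant term.\<close>

definition artanh_coeff :: "nat \<Rightarrow> 'a :: field_char_0" where
  "artanh_coeff k = (1 - (-1) ^ k) / (2 * of_nat k)"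

definition fps_artanh :: "'a :: field_char_0 fps" where
  "fps_artanh = Abs_fps artanh_coeff"

definition fps_half_expm1 :: "'a :: field_char_0 fps" where
  "fps_half_expm1 = fps_const (1 / 2) * (fps_exp 2 - 1)"

text \<open>Substituting w into x / (1 + x) makes the i-th power the composition of
  \<open>fps_geometric_power i\<close> with w, whose coefficients can be read off.\<close>

definition fps_tanh :: "'a :: field_char_0 fps" where
  "fps_tanh = fps_geometric_power 1 oo fps_half_expm1"

lemma fps_half_expm1_nth_0 [simp]: "fps_half_expm1 $ 0 = 0"
  by (simp add: fps_half_expm1_def)

lemma fps_tanh_nth_0 [simp]: "fps_tanh $ 0 = 0"
  by (simp add: fps_tanh_def fps_geometric_power_def)

lemma fps_tanh_eq: "(1 + fps_half_expm1) * fps_tanh = (fps_half_expm1 :: 'a :: field_char_0 fps)"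
proof -
  have "((1 + fps_X) * fps_geometric_power 1) oo fps_half_expm1 = (fps_X :: 'a fps) oo fps_half_expm1"
    using fps_geometric_power_Suc[of 0, where 'a = 'a] by simp
  then show ?thesis
    by (simp add: fps_tanh_def fps_compose_mult_distrib fps_compose_add_distrib)
qed

lemma fps_deriv_tanh: "fps_deriv fps_tanh = 1 - (fps_tanh :: 'a :: field_char_0 fps) ^ 2"
proof -
  let ?w = "fps_half_expm1 :: 'a fps" and ?H = "fps_tanh :: 'a fps"
  have dw: "fps_deriv ?w = 1 + 2 * ?w"
    by (rule fps_ext) (simp add: fps_half_expm1_def numeral_fps_const)
  have "fps_deriv ((1 + ?w) * ?H) = fps_deriv ?w"
    by (simp only: fps_tanh_eq)
  then have d: "(1 + ?w) * fps_deriv ?H = (1 + 2 * ?w) * (1 - ?H)"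
    by (simp add: dw algebra_simps)
  \<comment> \<open>Multiplying \<open>d\<close> by 1 + w and using (1 + w) H = w turns its right
    side into 1 + 2w = (1 + w)^2 - w^2.\<close>
  have "(1 + ?w) ^ 2 * fps_deriv ?H = (1 + ?w) ^ 2 * (1 - ?H ^ 2)"
    using d fps_tanh_eq[where 'a = 'a] by algebra
  moreover have "((1 + ?w) ^ 2) $ 0 \<noteq> 0" by simp
  then have "(1 + ?w) ^ 2 \<noteq> 0" by (metis fps_zero_nth)
  ultimately show ?thesis by (metis mult_left_cancel)
qed

text \<open>The derivative is 1 + x^2 + x^4 + ..., so multiplication by 1 - x^2 telescopes.\<close>

lemma fps_deriv_artanh: "fps_deriv fps_artanh * (1 - fps_X ^ 2) = (1 :: 'a :: field_char_0 fps)"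
proof -
  have "fps_deriv fps_artanh $ n = (1 + (-1) ^ n) / (2 :: 'a)" for n
    using of_nat_neq_0[of n, where 'a = 'a]
    by (simp add: fps_artanh_def artanh_coeff_def field_simps del: of_nat_Suc)
  then have deriv: "fps_deriv fps_artanh = Abs_fps (\<lambda>n. (1 + (-1) ^ n) / (2 :: 'a))"
    by (intro fps_ext) simp
  show ?thesis
  proof (rule fps_ext)
    fix n
    consider "n = 0" | "n = 1" | k where "n = Suc (Suc k)"
      by (metis One_nat_def not0_implies_Suc)
    then show "(fps_deriv fps_artanh * (1 - fps_X ^ 2)) $ n = (1 :: 'a fps) $ n"
      by cases (simp_all add: deriv right_diff_distrib fps_X_power_mult_right_nth)
  qed
qed

text \<open>By the chain rule and H' = 1 - H^2 the left side has derivative 1; both constant terms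
  are 0.\<close>

lemma fps_artanh_tanh: "fps_artanh oo fps_tanh = (fps_X :: 'a :: field_char_0 fps)"
proof -
  let ?H = "fps_tanh :: 'a fps"
  have "(fps_deriv fps_artanh * (1 - fps_X ^ 2)) oo ?H = 1"
    unfolding fps_deriv_artanh by simp
  then have "(fps_deriv fps_artanh oo ?H) * (1 - ?H ^ 2) = 1"
    by (simp add: fps_compose_mult_distrib fps_compose_sub_distrib fps_X_power_compose)
  then have "fps_deriv (fps_artanh oo ?H) = fps_deriv fps_X"
    by (simp add: fps_compose_deriv fps_deriv_tanh)
  then show ?thesis
    by (simp only: fps_deriv_eq_iff) (simp add: fps_artanh_def artanh_coeff_def)
qed

section \<open>Coefficients of powers of tanh\<close>

definition tanh_power_coeff :: "nat \<Rightarrow> nat \<Rightarrow> 'a :: field_char_0" where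
  "tanh_power_coeff n i = fact n * (fps_tanh ^ i) $ n"

lemma tanh_power_coeff_0 [simp]: "tanh_power_coeff n 0 = of_bool (n = 0)"
  by (auto simp: tanh_power_coeff_def)

text \<open>Multiplying artanh (tanh t) = t by tanh^m expands t tanh^m in powers of tanh. The
  coefficient of t^(n+1) is compared; the factorials supply the factor n + 1.\<close>

lemma tanh_power_coeff_Suc:
  assumes "m \<le> n"
  shows "of_nat (Suc n) * tanh_power_coeff n m =
    (\<Sum>i=Suc m..Suc n. artanh_coeff (i - m) * (tanh_power_coeff (Suc n) i :: 'a :: field_char_0))"
proof -
  let ?H = "fps_tanh :: 'a fps"
  have "?H ^ m * fps_X = (fps_X ^ m * fps_artanh) oo ?H"
    by (simp add: fps_compose_mult_distrib fps_X_power_compose fps_artanh_tanh)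
  then have "(?H ^ m) $ n = ((fps_X ^ m * fps_artanh) oo ?H) $ Suc n"
    by (metis fps_X_mult_right_nth diff_Suc_1 nat.distinct(1))
  also have "\<dots> = (\<Sum>i=0..Suc n. if i < m then 0 else artanh_coeff (i - m) * (?H ^ i) $ Suc n)"
    unfolding fps_compose_nth
    by (intro sum.cong) (auto simp: fps_X_power_mult_nth fps_artanh_def)
  also have "\<dots> = (\<Sum>i=Suc m..Suc n. artanh_coeff (i - m) * (?H ^ i) $ Suc n)"
    \<comment> \<open>The term i = m drops out because \<open>artanh_coeff 0\<close> is 0.\<close>
    by (intro sum.mono_neutral_cong_right) (auto simp: artanh_coeff_def not_less_eq_eq)
  finally show ?thesis
    by (simp add: tanh_power_coeff_def sum_distrib_left mult.left_commute mult.assoc del: sum.cl_ivl_Suc)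
qed

lemma tanh_power_coeff_explicit:
  assumes "1 \<le> i"
  shows "tanh_power_coeff n i = (\<Sum>j=i..n. (-1) ^ (j - i) * 2 ^ (n - j) * fact j
    * of_nat (Stirling n j) * (of_nat ((j - 1) choose (i - 1)) :: 'a :: field_char_0))"
proof -
  have w: "(fps_half_expm1 ^ j) $ n = (2 ^ (n - j) * fact j * of_nat (Stirling n j) / fact n :: 'a)"
    if "j \<le> n" for j
  proof -
    have "(fps_half_expm1 ^ j :: 'a fps) = fps_const ((1 / 2) ^ j) * (fps_exp 2 - 1) ^ j"
      by (simp add: fps_half_expm1_def power_mult_distrib)
    \<comment> \<open>The factor (1/2)^j from w^j meets 2^n from exp (2t), which leaves
      2^(n-j).\<close>
    then show ?thesis
      using that by (simp add: fps_exp_minus_one_power_nth power_diff power_one_over)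
  qed
  have "(fps_tanh ^ i :: 'a fps) = fps_geometric_power i oo fps_half_expm1"
    by (simp add: fps_tanh_def fps_geometric_power_eq[of i] fps_compose_power)
  then have "tanh_power_coeff n i = fact n * (\<Sum>j=0..n. fps_geometric_power i $ j * (fps_half_expm1 ^ j) $ n :: 'a)"
    by (simp add: tanh_power_coeff_def fps_compose_nth)
  also have "\<dots> = fact n * (\<Sum>j=i..n. fps_geometric_power i $ j * (fps_half_expm1 ^ j) $ n)"
    using assms by (intro arg_cong[where f = "(*) _"] sum.mono_neutral_right) (auto simp: fps_geometric_power_def)
  also have "\<dots> = (\<Sum>j=i..n. (-1) ^ (j - i) * 2 ^ (n - j) * fact j
    * of_nat (Stirling n j) * of_nat ((j - 1) choose (i - 1)))"
    unfolding sum_distrib_left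
    using assms by (intro sum.cong) (auto simp: w fps_geometric_power_def)
  finally show ?thesis .
qed

text \<open>The equation for m contains the entry in column m + 1 of row n + 1 with coefficient c 1
  = 1 and otherwise only columns further right. So row n determines row n + 1 from right to left,
  except for column 0, which \<open>init\<close> supplies.\<close>

lemma triangular_recurrence_unique:
  fixes f g :: "nat \<Rightarrow> nat \<Rightarrow> 'a :: comm_ring_1"
  assumes f: "\<And>n m. m \<le> n \<Longrightarrow> n < N \<Longrightarrow>
      of_nat (Suc n) * f n m = (\<Sum>i=Suc m..Suc n. c (i - m) * f (Suc n) i)"
    and g: "\<And>n m. m \<le> n \<Longrightarrow> n < N \<Longrightarrow>
      of_nat (Suc n) * g n m = (\<Sum>i=Suc m..Suc n. c (i - m) * g (Suc n) i)"
    and c: "c 1 = 1" and init: "\<And>n. f n 0 = g n 0"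
  shows "i \<le> n \<Longrightarrow> n \<le> N \<Longrightarrow> f n i = g n i"
proof (induction n arbitrary: i)
  case 0
  then show ?case by (simp add: init)
next
  case (Suc n)
  note IH_n = Suc.IH and n_le = \<open>Suc n \<le> N\<close>
  from Suc.prems(1) show ?case
  proof (induction i rule: measure_induct_rule[where f = "\<lambda>i. Suc n - i"])
    case (less i)
    show ?case
    proof (cases i)
      case 0
      then show ?thesis by (simp add: init)
    next
      case (Suc m)
      have head: "(\<Sum>k=Suc m..Suc n. c (k - m) * h k) = h i + (\<Sum>k=Suc i..Suc n. c (k - m) * h k)"
        for h :: "nat \<Rightarrow> 'a"
        using less.prems Suc c by (simp add: sum.atLeast_Suc_atMost del: sum.cl_ivl_Suc)
      have "(\<Sum>k=Suc i..Suc n. c (k - m) * f (Suc n) k) = (\<Sum>k=Suc i..Suc n. c (k - m) * g (Suc n) k)"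
        using less.IH by (intro sum.cong) auto
      moreover have "f n m = g n m"
        using IH_n n_le less.prems Suc by simp
      ultimately show ?thesis
        using f[of m n] g[of m n] head less.prems Suc n_le by (simp del: sum.cl_ivl_Suc)
    qed
  qed
qed

section \<open>Comparing linear coefficients in the intertwining relation\<close>

definition linear_coeff :: "nat \<Rightarrow> qpoly \<Rightarrow> rat" where
  "linear_coeff m p = Poly_Mapping.lookup p (Poly_Mapping.single m 1)"

lemma linear_coeff_sum: "linear_coeff m (sum f A) = (\<Sum>i\<in>A. linear_coeff m (f i))"
  by (simp add: linear_coeff_def lookup_sum)

lemma linear_coeff_scale: "linear_coeff m (scale c p) = c * linear_coeff m p"
proof -
  have "scale c p = Poly_Mapping.map ((*) c) p"
    unfolding scale_def by (metis mult_map_scale_conv_mult)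
  then show ?thesis by (simp add: linear_coeff_def map.rep_eq when_def)
qed

lemma linear_coeff_var: "linear_coeff m (var k) = of_bool (k = m)"
  by (auto simp: linear_coeff_def var_def lookup_single when_def
      dest!: arg_cong[where f = Poly_Mapping.keys])

lemma linear_coeff_combination:
  "linear_coeff m (\<Sum>i=1..n. scale (a i) (var i)) = (if m \<in> {1..n} then a m else 0)"
  by (simp add: linear_coeff_sum linear_coeff_scale linear_coeff_var of_bool_def if_distrib sum.delta
      cong: if_cong)

lemma linear_coeff_kravchuk1_var:
  "linear_coeff m (kravchuk1_var i) = (if m < i then artanh_coeff (i - m) else 0)"
proof -
  have "linear_coeff m (kravchuk1_var i) = (\<Sum>k=1..i. artanh_coeff k * of_bool (i - k = m))"
    by (simp only: kravchuk1_var_def linear_coeff_sum linear_coeff_scale linear_coeff_var artanh_coeff_def)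
  also have "\<dots> = (\<Sum>k=1..i. if k = i - m then of_bool (m < i) * artanh_coeff k else 0)"
    by (intro sum.cong) auto
  also have "\<dots> = (if m < i then artanh_coeff (i - m) else 0)"
    by (simp only: sum.delta finite_atLeastAtMost) auto
  finally show ?thesis .
qed

lemma kravchuk1_linear_combination:
  assumes "n \<le> N"
  shows "kravchuk1 N (\<Sum>i=1..n. scale (a i) (var i)) = (\<Sum>i=1..n. scale (a i) (kravchuk1_var i))"
proof -
  have "kravchuk1 N (\<Sum>i=1..n. scale (a i) (var i))
      = (\<Sum>i=1..n. \<Sum>k=1..N. scale (a i) (kravchuk1_var k * (if k = i then 1 else 0)))"
    unfolding kravchuk1_def
    by (subst sum.swap)
      (simp add: partial_deriv_sum partial_deriv_scale partial_deriv_var mult_scale sum_distrib_left)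
  also have "\<dots> = (\<Sum>i=1..n. scale (a i) (kravchuk1_var i))"
    using assms by (intro sum.cong) (auto simp: scale_def if_distrib cong: if_cong)
  finally show ?thesis .
qed

lemma weitzenboeck_var:
  assumes "1 \<le> n" "n \<le> N"
  shows "weitzenboeck N (var n) = scale (of_nat n) (var (n - 1))"
  using weitzenboeck_characterization[of N "weitzenboeck N"] assms by simp

text \<open>The relation is evaluated at the variable with index n + 1. It is stated with
  \<open>linear_coeff\<close> because T is constrained only for 1 \<le> i \<le> n \<le> N, while the
  recurrence also involves row 0 and column 0.\<close>

lemma intertwining_recurrence:
  assumes "intertwining_map N (weitzenboeck N) (kravchuk1 N) \<psi>"
    and var_0: "\<psi> (var 0) = var 0"
    and var: "\<forall>n\<in>{1..N}. \<psi> (var n) = (\<Sum>i=1..n. scale (T n i) (var i))"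
    and "n < N"
  shows "of_nat (Suc n) * linear_coeff m (\<psi> (var n))
    = (\<Sum>i=Suc m..Suc n. artanh_coeff (i - m) * linear_coeff i (\<psi> (var (Suc n))))"
proof -
  have coeff: "linear_coeff i (\<psi> (var (Suc n))) = T (Suc n) i" if "i \<in> {1..Suc n}" for i
    using var \<open>n < N\<close> that
    by (simp add: linear_coeff_combination[unfolded One_nat_def] del: sum.cl_ivl_Suc)
  have "var (Suc n) \<in> polys N" "var n \<in> polys N"
    using \<open>n < N\<close> by auto
  then have "\<psi> (weitzenboeck N (var (Suc n))) = kravchuk1 N (\<psi> (var (Suc n)))"
    and "\<psi> (scale (of_nat (Suc n)) (var n)) = scale (of_nat (Suc n)) (\<psi> (var n))"
    using assms(1) unfolding intertwining_map_def linear_on_polys_def by blast+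
  then have "scale (of_nat (Suc n)) (\<psi> (var n)) = kravchuk1 N (\<psi> (var (Suc n)))"
    using weitzenboeck_var[of "Suc n" N] \<open>n < N\<close> by simp
  also have "\<dots> = (\<Sum>i=1..Suc n. scale (T (Suc n) i) (kravchuk1_var i))"
    using var \<open>n < N\<close> kravchuk1_linear_combination[of "Suc n" N] by (simp del: sum.cl_ivl_Suc)
  finally have "of_nat (Suc n) * linear_coeff m (\<psi> (var n))
      = linear_coeff m (\<Sum>i=1..Suc n. scale (T (Suc n) i) (kravchuk1_var i))"
    by (metis linear_coeff_scale)
  also have "\<dots> = (\<Sum>i=1..Suc n. T (Suc n) i * (if m < i then artanh_coeff (i - m) else 0))"
    by (simp only: linear_coeff_sum linear_coeff_scale linear_coeff_kravchuk1_var)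
  also have "\<dots> = (\<Sum>i=Suc m..Suc n. artanh_coeff (i - m) * linear_coeff i (\<psi> (var (Suc n))))"
    by (intro sum.mono_neutral_cong_right) (auto simp: coeff)
  finally show ?thesis .
qed

theorem theorem3p1:
  fixes N :: nat and \<psi> :: "qpoly \<Rightarrow> qpoly" and T :: "nat \<Rightarrow> nat \<Rightarrow> rat"
  assumes "N \<ge> 1"
    and "intertwining_map N (weitzenboeck N) (kravchuk1 N) \<psi>"
    and "\<psi> (var 0) = var 0"
    and "\<forall>n\<in>{1..N}. \<psi> (var n) = (\<Sum>i=1..n. scale (T n i) (var i))"
  shows "\<forall>n i. 1 \<le> i \<and> i \<le> n \<and> n \<le> N \<longrightarrow>
    T n i = (\<Sum>j=i..n. (-1) ^ (j - i) * 2 ^ (n - j) * fact j * of_nat (Stirling n j)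
                         * of_nat ((j - 1) choose (i - 1)))"
proof (intro allI impI)
  fix n i assume ni: "1 \<le> i \<and> i \<le> n \<and> n \<le> N"
  \<comment> \<open>Beyond N, where \<psi> is not prescribed, f copies
    \<open>tanh_power_coeff\<close>, so that the two agree in column 0 for every n.\<close>
  define f where "f n i = (if n \<le> N then linear_coeff i (\<psi> (var n)) else tanh_power_coeff n i)" for n i
  have coeff: "linear_coeff i (\<psi> (var n)) = (if i \<in> {1..n} then T n i else 0)" if "n \<in> {1..N}" for n i
    using assms(4) that
    by (simp add: linear_coeff_combination[unfolded One_nat_def])
  have "f n i = tanh_power_coeff n i"
  proof (rule triangular_recurrence_unique[where N = N and c = artanh_coeff])
    fix n m assume "m \<le> n" "n < N"
    then show "of_nat (Suc n) * f n m = (\<Sum>i=Suc m..Suc n. artanh_coeff (i - m) * f (Suc n) i)"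
      using intertwining_recurrence[OF assms(2-4)] by (simp add: f_def del: sum.cl_ivl_Suc)
  next
    \<comment> \<open>For 1 \<le> n \<le> N the image of \<open>var n\<close> has no
      \<open>var 0\<close> term; for n = 0 the image is \<open>var 0\<close> itself, which gives
      1.\<close>
    show "f n 0 = tanh_power_coeff n 0" for n
      by (cases "n = 0") (auto simp: f_def coeff assms(3) linear_coeff_var)
  qed (use ni tanh_power_coeff_Suc in \<open>auto simp: artanh_coeff_def\<close>)
  then show "T n i = (\<Sum>j=i..n. (-1) ^ (j - i) * 2 ^ (n - j) * fact j * of_nat (Stirling n j)
                         * of_nat ((j - 1) choose (i - 1)))"
    using ni by (simp add: f_def coeff tanh_power_coeff_explicit)
qed

end
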